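(* Let $k\ge 5$ be an integer and let $P_k$ denote the path on $k$ vertices. Then $$\mathrm{ex}(n,P_k,\textup{rainbow-}P_k)=\Theta\big(n^{\lfloor k/2\rfloor}\big),$$ where the implied constants depend only on $k$ and $n\to\infty$.
   Context: An edge-coloring of a graph is proper if any two edges sharing a vertex receive different colors. A subgraph of an edge-colored graph is rainbow if all its edges have distinct colors. For graphs $H$ and $F$, $\mathrm{ex}(n,H,\textup{rainbow-}F)$ denotes the maximum number of copies of $H$ (subgraphs isomorphic to $H$) in a graph $G$ on $n$ vertices equipped with a proper edge-coloring in which there is no rainbow copy of $F$. *)

theory Defs
  imports Complex_Main "HOL-Library.Landau_Symbols"
begin

record 'a graph =
  verts :: "'a set"
  edges :: "'a set set"

definition simple_graph :: "'a graph \<Rightarrow> bool" where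
  "simple_graph G \<longleftrightarrow> finite (verts G) \<and> (\<forall>e\<in>edges G. e \<subseteq> verts G \<and> card e = 2)"

definition subgraph :: "'a graph \<Rightarrow> 'a graph \<Rightarrow> bool" where
  "subgraph S G \<longleftrightarrow> simple_graph S \<and> verts S \<subseteq> verts G \<and> edges S \<subseteq> edges G"

definition isomorphic :: "'a graph \<Rightarrow> 'b graph \<Rightarrow> bool" where
  "isomorphic G H \<longleftrightarrow>
     (\<exists>f. bij_betw f (verts G) (verts H) \<and> edges H = (\<lambda>e. f ` e) ` edges G)"

text \<open>Copies are subgraphs, not embeddings: they are not multiplied by automorphisms.\<close>

definition copies :: "'b graph \<Rightarrow> 'a graph \<Rightarrow> 'a graph set" where
  "copies H G = {S. subgraph S G \<and> isomorphic H S}"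

definition proper_coloring :: "'a graph \<Rightarrow> ('a set \<Rightarrow> 'c) \<Rightarrow> bool" where
  "proper_coloring G c \<longleftrightarrow>
     (\<forall>e\<in>edges G. \<forall>f\<in>edges G. e \<noteq> f \<and> e \<inter> f \<noteq> {} \<longrightarrow> c e \<noteq> c f)"

definition rainbow :: "('a set \<Rightarrow> 'c) \<Rightarrow> 'a graph \<Rightarrow> bool" where
  "rainbow c S \<longleftrightarrow> inj_on c (edges S)"

definition path_graph :: "nat \<Rightarrow> nat graph" where
  "path_graph k = \<lparr>verts = {..<k}, edges = {{i, Suc i} |i. Suc i < k}\<rparr>"

text \<open>
  The host graphs have natural numbers as vertices and as colors. This is no restriction, since
  every properly edge-colored finite simple graph is isomorphic to one of this form.
\<close>

definition rainbow_ex_counts :: "nat \<Rightarrow> 'a graph \<Rightarrow> 'b graph \<Rightarrow> nat set" where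
  "rainbow_ex_counts n H F =
     {card (copies H G) |(G :: nat graph) (c :: nat set \<Rightarrow> nat).
        simple_graph G \<and> card (verts G) = n \<and> proper_coloring G c \<and>
        \<not> (\<exists>S\<in>copies F G. rainbow c S)}"

definition rainbow_ex :: "nat \<Rightarrow> 'a graph \<Rightarrow> 'b graph \<Rightarrow> nat" where
  "rainbow_ex n H F = Max (rainbow_ex_counts n H F)"

text \<open>
  The set under \<^const>\<open>Max\<close> is always finite, and it is nonempty as soon as \<open>F\<close> has an edge.
\<close>

lemma finite_rainbow_ex_counts: "finite (rainbow_ex_counts n H F)"
proof -
  have "card (copies H G) \<le> 2 ^ n * 2 ^ (2 ^ n)"
    if G: "simple_graph G" "card (verts G) = n" for G :: "nat graph"
  proof -
    have fin: "finite (verts G)" using G by (simp add: simple_graph_def)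
    have "copies H G \<subseteq> (\<lambda>(V, E). \<lparr>verts = V, edges = E\<rparr>) ` (Pow (verts G) \<times> Pow (Pow (verts G)))"
    proof
      fix S assume "S \<in> copies H G"
      hence "verts S \<subseteq> verts G" "edges S \<subseteq> Pow (verts G)"
        by (auto simp: copies_def subgraph_def simple_graph_def)
      moreover have "S = (\<lambda>(V, E). \<lparr>verts = V, edges = E\<rparr>) (verts S, edges S)" by simp
      ultimately show "S \<in> (\<lambda>(V, E). \<lparr>verts = V, edges = E\<rparr>) ` (Pow (verts G) \<times> Pow (Pow (verts G)))"
        by blast
    qed
    hence "card (copies H G) \<le> card (Pow (verts G) \<times> Pow (Pow (verts G)))"
      using fin by (intro surj_card_le) auto
    also have "\<dots> = 2 ^ n * 2 ^ (2 ^ n)"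
      using fin G by (simp add: card_cartesian_product card_Pow)
    finally show ?thesis .
  qed
  hence "rainbow_ex_counts n H F \<subseteq> {..2 ^ n * 2 ^ (2 ^ n)}"
    by (auto simp: rainbow_ex_counts_def)
  thus ?thesis by (rule finite_subset) simp
qed

lemma rainbow_ex_counts_nonempty:
  assumes "edges F \<noteq> {}"
  shows "rainbow_ex_counts n H F \<noteq> {}"
proof -
  let ?G = "\<lparr>verts = {..<n}, edges = {}\<rparr> :: nat graph"
  have "copies F ?G = {}"
    using assms by (auto simp: copies_def subgraph_def isomorphic_def)
  hence "card (copies H ?G) \<in> rainbow_ex_counts n H F"
    unfolding rainbow_ex_counts_def
    by (intro CollectI exI[of _ ?G] exI[of _ "\<lambda>_. 0"])
       (auto simp: simple_graph_def proper_coloring_def)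
  thus ?thesis by blast
qed

end

theory Submission imports Defs "HOL-Library.FuncSet" begin

text \<open>
  Upper bound: greedily extending a rainbow path shows that the host graph has \<open>O(n)\<close> edges. If \<open>k\<close> is
  even, every other edge of a path determines it, so there are \<open>O(n ^ (k div 2))\<close> paths. If \<open>k\<close> is
  odd, each path has two edges of the same colour; an endpoint of one of them is determined by its
  neighbour and that colour, and choosing it at even distance from the start leaves vertices
  perfectly matched by \<open>k div 2\<close> edges of the path.

  Lower bound: take \<open>k\<close> levels of vertices, where the levels 1, 4, 6, 8, ... have a single vertex,
  a hub, the other levels have about \<open>n / k\<close> vertices, consecutive levels 2 and 3 are joined by a
  perfect matching, and all other pairs of consecutive levels are joined completely. Every matching
  edge gets the colour 0, and the two edges joining a matched pair to hubs 1 and 4 share a colour.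
  A rainbow path has at most one edge of colour 0, so at least \<open>k - 2\<close> of its edges meet a hub, each
  hub accounting for at most two. By counting, the path contains hub 1 and another hub, and to get
  from one to the other it has to use two edges of the same colour.
\<close>

section \<open>Copies of a path as vertex sequences\<close>

definition is_path :: "'a graph \<Rightarrow> nat \<Rightarrow> (nat \<Rightarrow> 'a) \<Rightarrow> bool" where
  "is_path G k f \<longleftrightarrow> f ` {..<k} \<subseteq> verts G \<and> inj_on f {..<k} \<and>
     (\<forall>i. Suc i < k \<longrightarrow> {f i, f (Suc i)} \<in> edges G)"

definition rainbow_path :: "('a set \<Rightarrow> 'c) \<Rightarrow> nat \<Rightarrow> (nat \<Rightarrow> 'a) \<Rightarrow> bool" where
  "rainbow_path c k f \<longleftrightarrow> inj_on (\<lambda>i. c {f i, f (Suc i)}) {i. Suc i < k}"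

definition path_image :: "nat \<Rightarrow> (nat \<Rightarrow> 'a) \<Rightarrow> 'a graph" where
  "path_image k f = \<lparr>verts = f ` {..<k}, edges = (\<lambda>i. {f i, f (Suc i)}) ` {i. Suc i < k}\<rparr>"

lemma is_path_edge: "is_path G k f \<Longrightarrow> Suc i < k \<Longrightarrow> {f i, f (Suc i)} \<in> edges G"
  by (simp add: is_path_def)

lemma is_path_eq_iff: "is_path G k f \<Longrightarrow> i < k \<Longrightarrow> j < k \<Longrightarrow> f i = f j \<longleftrightarrow> i = j"
  by (auto simp: is_path_def inj_on_def)

lemma path_image_cong: "(\<And>i. i < k \<Longrightarrow> f i = g i) \<Longrightarrow> path_image k f = path_image k g"
  by (auto simp: path_image_def intro!: image_cong)

text \<open>Since distinct indices give distinct edges, being rainbow can be tested on indices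
  instead of on the edge set.\<close>

lemma path_edges_inj:
  assumes "is_path G k f"
  shows "inj_on (\<lambda>i. {f i, f (Suc i)}) {i. Suc i < k}"
proof (rule inj_onI)
  fix i j assume "i \<in> {i. Suc i < k}" "j \<in> {i. Suc i < k}"
    and eq: "{f i, f (Suc i)} = {f j, f (Suc j)}"
  hence ij: "Suc i < k" "Suc j < k" by auto
  from eq have "(f i = f j \<and> f (Suc i) = f (Suc j)) \<or> (f i = f (Suc j) \<and> f (Suc i) = f j)"
    by (simp add: doubleton_eq_iff)
  thus "i = j"
    using ij is_path_eq_iff[OF assms, of i j] is_path_eq_iff[OF assms, of i "Suc j"]
      is_path_eq_iff[OF assms, of "Suc i" j] by auto
qed

lemma rainbow_path_image_iff:
  assumes "is_path G k f"
  shows "rainbow c (path_image k f) \<longleftrightarrow> rainbow_path c k f"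
  using comp_inj_on_iff[OF path_edges_inj[OF assms], of c]
  by (simp add: rainbow_def rainbow_path_def path_image_def comp_def)

text \<open>Extensionality makes the set of sequences finite in a finite graph. For
  \<open>k >= 2\<close> each copy comes from both of its traversals, so counting sequences bounds
  the number of copies from above.\<close>

lemma copies_path_graph:
  assumes "simple_graph G"
  shows "copies (path_graph k) G = path_image k ` {f \<in> extensional {..<k}. is_path G k f}"
proof (intro equalityI subsetI)
  fix S assume S: "S \<in> copies (path_graph k) G"
  then obtain f where f: "bij_betw f {..<k} (verts S)"
    "edges S = (\<lambda>e. f ` e) ` {{i, Suc i} |i. Suc i < k}" 
    and sub: "verts S \<subseteq> verts G" "edges S \<subseteq> edges G"
    by (auto simp: copies_def isomorphic_def path_graph_def subgraph_def)
  have es: "edges S = (\<lambda>i. {f i, f (Suc i)}) ` {i. Suc i < k}"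
    using f(2) by (auto simp: image_iff) blast
  let ?f = "restrict f {..<k}"
  have vs: "verts S = f ` {..<k}" using f(1) by (simp add: bij_betw_def)
  have "S = path_image k f" using vs es by (simp add: path_image_def)
  also have "\<dots> = path_image k ?f" by (rule path_image_cong) simp
  finally have "S = path_image k ?f" .
  moreover have "is_path G k ?f"
    using f(1) vs es sub by (auto simp: is_path_def bij_betw_def inj_on_def)
  ultimately show "S \<in> path_image k ` {f \<in> extensional {..<k}. is_path G k f}" by auto
next
  fix S assume "S \<in> path_image k ` {f \<in> extensional {..<k}. is_path G k f}"
  then obtain f where f: "is_path G k f" "S = path_image k f" by auto
  have "isomorphic (path_graph k) S"
    unfolding isomorphic_def
  proof (intro exI[of _ f] conjI)
    show "bij_betw f (verts (path_graph k)) (verts S)"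
      using f by (simp add: is_path_def path_graph_def path_image_def bij_betw_def)
    show "edges S = (\<lambda>e. f ` e) ` edges (path_graph k)"
      using f(2) by (auto simp: path_graph_def path_image_def image_iff) blast
  qed
  moreover have "subgraph S G"
    using f assms is_path_eq_iff[OF f(1)]
    by (auto simp: subgraph_def simple_graph_def path_image_def is_path_def card_insert_if)
  ultimately show "S \<in> copies (path_graph k) G" by (simp add: copies_def)
qed

lemma rainbow_copy_iff:
  assumes "simple_graph G"
  shows "(\<exists>S\<in>copies (path_graph k) G. rainbow c S) \<longleftrightarrow> (\<exists>f. is_path G k f \<and> rainbow_path c k f)"
proof
  assume "\<exists>S\<in>copies (path_graph k) G. rainbow c S"
  then obtain f where "is_path G k f" "rainbow c (path_image k f)"
    by (auto simp: copies_path_graph[OF assms])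
  thus "\<exists>f. is_path G k f \<and> rainbow_path c k f"
    using rainbow_path_image_iff by blast
next
  assume "\<exists>f. is_path G k f \<and> rainbow_path c k f"
  then obtain f where f: "is_path G k f" "rainbow_path c k f" by auto
  let ?f = "restrict f {..<k}"
  have p: "is_path G k ?f" using f(1) by (auto simp: is_path_def inj_on_def)
  have "rainbow_path c k ?f" using f(2) by (simp add: rainbow_path_def inj_on_def)
  thus "\<exists>S\<in>copies (path_graph k) G. rainbow c S"
    using rainbow_path_image_iff[OF p] p by (auto simp: copies_path_graph[OF assms])
qed

section \<open>Sparsity of host graphs without a rainbow path\<close>

lemma simple_graph_finite_edges: "simple_graph G \<Longrightarrow> finite (edges G)"
  by (rule finite_subset[of _ "Pow (verts G)"]) (auto simp: simple_graph_def)

lemma simple_graph_edgeE: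
  assumes "simple_graph G" "e \<in> edges G" "w \<in> e"
  obtains x where "e = {w, x}" "x \<noteq> w" "x \<in> verts G"
proof -
  have "card e = 2" "e \<subseteq> verts G" using assms by (auto simp: simple_graph_def)
  thus ?thesis using assms(3) that by (auto simp: card_2_iff)
qed

lemma proper_coloringD:
  assumes "proper_coloring G c" "{u, v} \<in> edges G" "{u, w} \<in> edges G" "c {u, v} = c {u, w}"
  shows "v = w"
proof (rule ccontr)
  assume "v \<noteq> w"
  hence "{u, v} \<noteq> {u, w}" by (simp add: doubleton_eq_iff)
  moreover have "{u, v} \<inter> {u, w} \<noteq> {}" by simp
  ultimately have "c {u, v} \<noteq> c {u, w}"
    using assms(1)[unfolded proper_coloring_def, rule_format, OF assms(2,3)] by simp
  thus False using assms(4) by simp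
qed

text \<open>At the last of \<open>Suc t\<close> vertices, at most \<open>Suc t\<close> edges lead
  back to the path and, the colouring being proper, at most \<open>t\<close> edges have a colour
  already used. That excludes fewer than \<open>2 * k\<close> edges, so some edge extends the
  path.\<close>

lemma rainbow_path_greedy:
  assumes G: "simple_graph G" "proper_coloring G c" "verts G \<noteq> {}"
    and deg: "\<And>v. v \<in> verts G \<Longrightarrow> 2 * k \<le> card {e \<in> edges G. v \<in> e}"
    and "t < k"
  shows "\<exists>f. is_path G (Suc t) f \<and> rainbow_path c (Suc t) f"
  using \<open>t < k\<close>
proof (induction t)
  case 0
  from G(3) obtain v where "v \<in> verts G" by auto
  thus ?case by (intro exI[of _ "\<lambda>_. v"]) (auto simp: is_path_def rainbow_path_def inj_on_def)
next
  case (Suc t)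
  then obtain f where f: "is_path G (Suc t) f" "rainbow_path c (Suc t) f" by auto
  define w where "w = f t"
  define X where "X = {e \<in> edges G. w \<in> e}"
  define B1 where "B1 = (\<lambda>i. {w, f i}) ` {..<Suc t}"
  define C where "C = (\<lambda>i. c {f i, f (Suc i)}) ` {..<t}"
  define B2 where "B2 = {e \<in> X. c e \<in> C}"
  have wV: "w \<in> verts G" using f(1) by (auto simp: is_path_def w_def)
  have finX: "finite X" using simple_graph_finite_edges[OF G(1)] by (simp add: X_def)
  have "card B1 \<le> Suc t" unfolding B1_def using card_image_le[of "{..<Suc t}"] by simp
  moreover have "card B2 \<le> t"
  proof -
    have "inj_on c B2"
      using G(2) unfolding B2_def X_def proper_coloring_def inj_on_def by blast
    hence "card B2 \<le> card C" by (rule card_inj_on_le) (auto simp: B2_def C_def)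
    also have "\<dots> \<le> t" unfolding C_def using card_image_le[of "{..<t}"] by simp
    finally show ?thesis .
  qed
  ultimately have "card (B1 \<union> B2) < 2 * k" using Suc.prems card_Un_le[of B1 B2] by simp
  hence "card (B1 \<union> B2) < card X" using deg[OF wV] by (simp add: X_def)
  moreover have "finite (B1 \<union> B2)" using finX by (simp add: B1_def B2_def)
  ultimately have "\<not> X \<subseteq> B1 \<union> B2" using card_mono by (metis leD)
  then obtain e where e: "e \<in> X" "e \<notin> B1" "e \<notin> B2" by auto
  then obtain x where x: "e = {w, x}" "x \<in> verts G"
    using simple_graph_edgeE[OF G(1), of e w] by (auto simp: X_def)
  have xn: "x \<noteq> f i" if "i < Suc t" for i using e(2) that x(1) by (auto simp: B1_def)
  have cn: "c e \<noteq> c {f i, f (Suc i)}" if "i < t" for i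
    using e that by (auto simp: B2_def C_def)
  let ?g = "f(Suc t := x)"
  have "is_path G (Suc (Suc t)) ?g"
    unfolding is_path_def
  proof (intro conjI allI impI)
    show "?g ` {..<Suc (Suc t)} \<subseteq> verts G"
      using f(1) x(2) by (auto simp: is_path_def)
    have "inj_on ?g {..<Suc t}" using f(1) by (auto simp: is_path_def inj_on_def)
    moreover have "?g (Suc t) \<notin> ?g ` {..<Suc t}" using xn by auto
    ultimately show "inj_on ?g {..<Suc (Suc t)}"
      by (subst lessThan_Suc) (auto simp: inj_on_insert)
    show "{?g i, ?g (Suc i)} \<in> edges G" if "Suc i < Suc (Suc t)" for i
      using that f(1) e(1) x(1) by (cases "i = t") (auto simp: is_path_def w_def X_def)
  qed
  moreover have "rainbow_path c (Suc (Suc t)) ?g"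
  proof -
    have "{i. Suc i < Suc (Suc t)} = insert t {..<t}" "{i. Suc i < Suc t} = {..<t}" by auto
    moreover have "inj_on (\<lambda>i. c {?g i, ?g (Suc i)}) {..<t} \<longleftrightarrow> inj_on (\<lambda>i. c {f i, f (Suc i)}) {..<t}"
      by (rule inj_on_cong) simp
    moreover have "c {?g t, ?g (Suc t)} \<notin> (\<lambda>i. c {?g i, ?g (Suc i)}) ` {..<t}"
      using cn by (force simp: x(1) w_def)
    ultimately show ?thesis
      using f(2) by (simp add: rainbow_path_def inj_on_insert)
  qed
  ultimately show ?case by blast
qed

text \<open>By the greedy extension some vertex has degree below \<open>2 * k\<close>; deleting it
  and inducting charges fewer than \<open>2 * k\<close> edges to each vertex.\<close>

lemma rainbow_path_free_sparse:
  assumes "simple_graph G" "proper_coloring G c" "k > 0"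
    and "\<not> (\<exists>f. is_path G k f \<and> rainbow_path c k f)"
  shows "card (edges G) \<le> 2 * k * card (verts G)"
  using assms
proof (induction "card (verts G)" arbitrary: G rule: less_induct)
  case less
  note G = less.prems
  have finV: "finite (verts G)" using G(1) by (simp add: simple_graph_def)
  show ?case
  proof (cases "verts G = {}")
    case True
    hence "edges G = {}" using G(1) by (auto simp: simple_graph_def)
    thus ?thesis by simp
  next
    case False
    have "\<not> (\<forall>v\<in>verts G. 2 * k \<le> card {e \<in> edges G. v \<in> e})"
      using rainbow_path_greedy[OF G(1,2) False, of k "k - 1"] G(3,4) by auto
    then obtain v where v: "v \<in> verts G" "card {e \<in> edges G. v \<in> e} < 2 * k"
      by (auto simp: not_le)
    define H where "H = \<lparr>verts = verts G - {v}, edges = {e \<in> edges G. v \<notin> e}\<rparr>"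
    have lt: "card (verts H) < card (verts G)"
      using card_Diff1_less[OF finV v(1)] by (simp add: H_def)
    have sH: "simple_graph H" using G(1) by (auto simp: H_def simple_graph_def)
    have pH: "proper_coloring H c" using G(2) by (auto simp: H_def proper_coloring_def)
    have "is_path G k f" if "is_path H k f" for f
      using that by (auto simp: H_def is_path_def)
    hence "\<not> (\<exists>f. is_path H k f \<and> rainbow_path c k f)" using G(4) by blast
    hence IH: "card (edges H) \<le> 2 * k * card (verts H)"
      using less.hyps[OF lt sH pH G(3)] by blast
    have "edges G = edges H \<union> {e \<in> edges G. v \<in> e}" by (auto simp: H_def)
    hence "card (edges G) \<le> card (edges H) + card {e \<in> edges G. v \<in> e}"
      by (metis card_Un_le)
    also have "\<dots> \<le> 2 * k * card (verts H) + 2 * k" using IH v(2) by simp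
    also have "\<dots> = 2 * k * Suc (card (verts H))" by simp
    also have "\<dots> \<le> 2 * k * card (verts G)" using lt by (intro mult_le_mono2) simp
    finally show ?thesis .
  qed
qed

section \<open>Counting paths by the edges that determine them\<close>

lemma card_arcs_le:
  assumes "simple_graph G"
  shows "finite {(u, v). {u, v} \<in> edges G}" "card {(u, v). {u, v} \<in> edges G} \<le> 2 * card (edges G)"
proof -
  have fin: "finite (verts G)" using assms by (simp add: simple_graph_def)
  have "{(u, v). {u, v} \<in> edges G} \<subseteq> verts G \<times> verts G"
    using assms by (auto simp: simple_graph_def)
  thus fA: "finite {(u, v). {u, v} \<in> edges G}"
    by (rule finite_subset) (simp add: fin)
  have "{(u, v). {u, v} \<in> edges G} = (\<Union>e\<in>edges G. {(u, v). {u, v} = e})" by auto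
  also have "card \<dots> \<le> (\<Sum>e\<in>edges G. card {(u, v). {u, v} = e})"
    by (rule card_UN_le) (rule simple_graph_finite_edges[OF assms])
  also have "\<dots> \<le> (\<Sum>e\<in>edges G. 2)"
  proof (rule sum_mono)
    fix e assume "e \<in> edges G"
    hence "card e = 2" using assms by (simp add: simple_graph_def)
    then obtain x y where "e = {x, y}" by (auto simp: card_2_iff)
    hence "{(u, v). {u, v} = e} \<subseteq> {(x, y), (y, x)}" by (auto simp: doubleton_eq_iff)
    hence "card {(u, v). {u, v} = e} \<le> card {(x, y), (y, x)}" by (intro card_mono) auto
    also have "\<dots> \<le> 2" by (rule card_insert_le_m1) simp_all
    finally show "card {(u, v). {u, v} = e} \<le> 2" .
  qed
  finally show "card {(u, v). {u, v} \<in> edges G} \<le> 2 * card (edges G)" by simp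
qed

text \<open>A path is encoded by its ordered edges at the positions \<open>a t\<close>. The encoding
  is injective by \<open>det\<close>, and each of its \<open>m\<close> entries has at most
  \<open>2 * card (edges G)\<close> values.\<close>

lemma card_paths_le:
  assumes G: "simple_graph G"
    and T: "\<And>f. f \<in> T \<Longrightarrow> is_path G k f"
    and a: "\<And>t. t < m \<Longrightarrow> Suc (a t) < k"
    and det: "\<And>f g. f \<in> T \<Longrightarrow> g \<in> T \<Longrightarrow>
      (\<And>t. t < m \<Longrightarrow> f (a t) = g (a t) \<and> f (Suc (a t)) = g (Suc (a t))) \<Longrightarrow> f = g"
  shows "card T \<le> (2 * card (edges G)) ^ m"
proof -
  let ?A = "{(u, v). {u, v} \<in> edges G}"
  let ?h = "\<lambda>f. \<lambda>t\<in>{..<m}. (f (a t), f (Suc (a t)))"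
  have "inj_on ?h T"
  proof (rule inj_onI)
    fix f g assume fg: "f \<in> T" "g \<in> T" and eq: "?h f = ?h g"
    show "f = g"
    proof (rule det[OF fg])
      fix t assume "t < m"
      thus "f (a t) = g (a t) \<and> f (Suc (a t)) = g (Suc (a t))"
        using fun_cong[OF eq, of t] by simp
    qed
  qed
  moreover have "?h ` T \<subseteq> {..<m} \<rightarrow>\<^sub>E ?A"
  proof (intro image_subsetI)
    fix f assume f: "f \<in> T"
    show "?h f \<in> {..<m} \<rightarrow>\<^sub>E ?A"
    proof (rule restrict_PiE_iff[THEN iffD2], rule ballI)
      fix t assume "t \<in> {..<m}"
      hence "Suc (a t) < k" using a by simp
      thus "(f (a t), f (Suc (a t))) \<in> ?A" using is_path_edge[OF T[OF f]] by simp
    qed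
  qed
  ultimately have "card T \<le> card ({..<m} \<rightarrow>\<^sub>E ?A)"
    by (rule card_inj_on_le) (simp add: finite_PiE card_arcs_le[OF G])
  also have "\<dots> = card ?A ^ m" by (simp add: card_PiE)
  also have "\<dots> \<le> (2 * card (edges G)) ^ m"
    by (intro power_mono card_arcs_le[OF G]) simp
  finally show ?thesis .
qed

text \<open>Given the path without \<open>f r\<close>, the vertex \<open>f r\<close> is the neighbour of \<open>f q\<close> along the edge of colour
  \<open>c {f i, f (Suc i)}\<close>; as \<open>r\<close> is even, the other vertices are matched by \<open>k div 2\<close> path edges.\<close>

lemma card_paths_repeated_color_le:
  assumes G: "simple_graph G" "proper_coloring G c"
    and k: "odd k" and r: "even r" "r < k" and q: "q < k" "q \<noteq> r"
    and i: "Suc i < k" "i \<noteq> r" "Suc i \<noteq> r"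
  shows "card {f \<in> extensional {..<k}. is_path G k f \<and> {f q, f r} \<in> edges G \<and>
            c {f q, f r} = c {f i, f (Suc i)}} \<le> (2 * card (edges G)) ^ (k div 2)"
    (is "card ?T \<le> _")
\<comment> \<open>Position \<open>r\<close> is left out: the pairs are 0 and 1 up to
  \<open>r - 2\<close> and \<open>r - 1\<close>, then \<open>r + 1\<close> and \<open>r + 2\<close>
  up to \<open>k - 2\<close> and \<open>k - 1\<close>. They fit because \<open>r\<close> is even and
  \<open>k\<close> is odd.\<close>
proof (rule card_paths_le[OF G(1), where k = k and a = "\<lambda>t. if t < r div 2 then 2 * t else Suc (2 * t)"])
  show "is_path G k f" if "f \<in> ?T" for f using that by simp
  show "Suc (if t < r div 2 then 2 * t else Suc (2 * t)) < k" if "t < k div 2" for t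
  proof -
    have "Suc (Suc (2 * t)) < k" using that k by presburger
    thus ?thesis by simp
  qed
next
  fix f g
  assume f: "f \<in> ?T" and g: "g \<in> ?T"
    and eq: "\<And>t. t < k div 2 \<Longrightarrow>
      f (if t < r div 2 then 2 * t else Suc (2 * t)) = g (if t < r div 2 then 2 * t else Suc (2 * t)) \<and>
      f (Suc (if t < r div 2 then 2 * t else Suc (2 * t))) = g (Suc (if t < r div 2 then 2 * t else Suc (2 * t)))"
  obtain s where s: "r = 2 * s" using r(1) by (rule evenE)
  obtain n where n: "k = 2 * n + 1" using k by (rule oddE)
  have kn: "k div 2 = n" "r div 2 = s" using s n by simp_all
  have left: "f (2 * t) = g (2 * t)" "f (Suc (2 * t)) = g (Suc (2 * t))" if "t < n" "t < s" for t
    using eq[of t] that by (simp_all add: kn)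
  have right: "f (Suc (2 * t)) = g (Suc (2 * t))" "f (Suc (Suc (2 * t))) = g (Suc (Suc (2 * t)))"
    if "t < n" "\<not> t < s" for t
    using eq[of t] that by (simp_all add: kn)
  have eq': "f l = g l" if l: "l < k" "l \<noteq> r" for l
  proof (cases "l < r")
    case True
    obtain t where t: "l = 2 * t \<or> l = Suc (2 * t)" by (metis evenE oddE Suc_eq_plus1)
    hence "t < s" "t < n" using True r(2) unfolding s n by linarith+
    with t left show ?thesis by metis
  next
    case False
    hence "l > r" using l(2) by simp
    then obtain l' where l': "l = Suc l'" "r \<le> l'" by (cases l) auto
    obtain t where t: "l' = 2 * t \<or> l' = Suc (2 * t)" by (metis evenE oddE Suc_eq_plus1)
    hence "\<not> t < s" "t < n" using l' l(1) unfolding s n by linarith+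
    with t l'(1) right show ?thesis by metis
  qed
  have "f q = g q" "f i = g i" "f (Suc i) = g (Suc i)"
    by (rule eq'; use q i in simp)+
  hence "f r = g r"
    using proper_coloringD[OF G(2), of "f q" "f r" "g r"] f g by simp
  hence "f l = g l" if "l < k" for l using eq' that by (cases "l = r") auto
  moreover have "f \<in> extensional {..<k}" "g \<in> extensional {..<k}" using f g by simp_all
  ultimately show "f = g" by (intro extensionalityI[of f "{..<k}" g]) simp_all
qed

text \<open>For odd \<open>k\<close> the factor \<open>k ^ 3\<close> bounds the number of triples
  \<open>(i, r, q)\<close>: the edge at \<open>i\<close> supplies the colour, and the edge joining
  positions \<open>q\<close> and \<open>r\<close> repeats it. For even \<open>k\<close> a single
  term suffices.\<close>

lemma card_path_copies_le:
  assumes G: "simple_graph G" "proper_coloring G c"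
    and free: "\<not> (\<exists>f. is_path G k f \<and> rainbow_path c k f)"
  shows "card (copies (path_graph k) G) \<le> k ^ 3 * (2 * card (edges G)) ^ (k div 2)"
proof -
  let ?P = "{f \<in> extensional {..<k}. is_path G k f}"
  let ?M = "(2 * card (edges G)) ^ (k div 2)"
  have "k \<noteq> 0"
  proof
    assume "k = 0"
    hence "is_path G k f \<and> rainbow_path c k f" for f by (simp add: is_path_def rainbow_path_def)
    thus False using free by blast
  qed
  have "?P \<subseteq> {..<k} \<rightarrow>\<^sub>E verts G"
    by (auto simp: is_path_def PiE_def)
  hence finP: "finite ?P"
    by (rule finite_subset) (use G(1) in \<open>auto simp: simple_graph_def intro!: finite_PiE\<close>)
  have "card ?P \<le> k ^ 3 * ?M"
  proof (cases "even k")
    case True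
    have "card ?P \<le> ?M"
    proof (rule card_paths_le[OF G(1), where k = k and a = "\<lambda>t. 2 * t"])
      show "is_path G k f" if "f \<in> ?P" for f using that by simp
      show "Suc (2 * t) < k" if "t < k div 2" for t using that True by (auto elim!: evenE)
    next
      fix f g assume fg: "f \<in> ?P" "g \<in> ?P"
        and eq: "\<And>t. t < k div 2 \<Longrightarrow> f (2 * t) = g (2 * t) \<and> f (Suc (2 * t)) = g (Suc (2 * t))"
      have "f l = g l" if "l < k" for l
      proof -
        have "l div 2 < k div 2" "l = 2 * (l div 2) \<or> l = Suc (2 * (l div 2))"
          using that True by presburger+
        thus ?thesis using eq[of "l div 2"] by auto
      qed
      moreover have "f \<in> extensional {..<k}" "g \<in> extensional {..<k}" using fg by simp_all
      ultimately show "f = g" by (intro extensionalityI[of f "{..<k}" g]) simp_all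
    qed
    also have "\<dots> \<le> k ^ 3 * ?M" using \<open>k \<noteq> 0\<close> by simp
    finally show ?thesis .
  next
    case False
    define T where "T = (\<lambda>(i, r, q). {f \<in> extensional {..<k}. is_path G k f \<and>
      {f q, f r} \<in> edges G \<and> c {f q, f r} = c {f i, f (Suc i)}})"
    \<comment> \<open>As \<open>r\<close> avoids \<open>i\<close> and \<open>Suc i\<close>, both
      ends of the edge supplying the colour survive the omission of \<open>r\<close>.\<close>
    define I where "I = {(i, r, q). Suc i < k \<and> i \<noteq> r \<and> Suc i \<noteq> r \<and> even r \<and> r < k \<and> q < k \<and> q \<noteq> r}"
    have Isub: "I \<subseteq> {..<k} \<times> {..<k} \<times> {..<k}" by (auto simp: I_def)
    hence finI: "finite I" by (rule finite_subset) simp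
    have "card I \<le> k ^ 3"
      using card_mono[OF _ Isub] by (simp add: card_cartesian_product power3_eq_cube mult.assoc)
    have "?P \<subseteq> (\<Union>x\<in>I. T x)"
    proof
      fix f assume f: "f \<in> ?P"
      hence p: "is_path G k f" by simp
      with free have "\<not> rainbow_path c k f" by blast
      then obtain i j where ij: "Suc i < k" "Suc j < k" "i \<noteq> j"
        and ceq: "c {f i, f (Suc i)} = c {f j, f (Suc j)}"
        by (auto simp: rainbow_path_def inj_on_def)
      \<comment> \<open>Edges of equal colour share no vertex, so their indices are not
        consecutive.\<close>
      have ne: "i \<noteq> Suc j" "j \<noteq> Suc i"
      proof -
        show "i \<noteq> Suc j"
        proof
          assume "i = Suc j"
          thus False using proper_coloringD[OF G(2), of "f i" "f (Suc i)" "f j"] ceq ij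
              is_path_edge[OF p ij(1)] is_path_edge[OF p ij(2)] is_path_eq_iff[OF p, of "Suc i" j]
            by (simp add: insert_commute)
        qed
        show "j \<noteq> Suc i"
        proof
          assume "j = Suc i"
          thus False using proper_coloringD[OF G(2), of "f j" "f (Suc j)" "f i"] ceq ij
              is_path_edge[OF p ij(1)] is_path_edge[OF p ij(2)] is_path_eq_iff[OF p, of "Suc j" i]
            by (simp add: insert_commute)
        qed
      qed
      show "f \<in> (\<Union>x\<in>I. T x)"
      \<comment> \<open>One end of the edge at \<open>j\<close> sits at an even position; that end
        is taken as \<open>r\<close>, the other as \<open>q\<close>.\<close>
      proof (cases "even j")
        case True
        hence "(i, j, Suc j) \<in> I" using ij ne by (auto simp: I_def)
        moreover have "f \<in> T (i, j, Suc j)"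
          using f ceq is_path_edge[OF p ij(2)] by (simp add: T_def insert_commute)
        ultimately show ?thesis by blast
      next
        case False
        hence "(i, Suc j, j) \<in> I" using ij ne by (auto simp: I_def)
        moreover have "f \<in> T (i, Suc j, j)"
          using f ceq is_path_edge[OF p ij(2)] by (simp add: T_def)
        ultimately show ?thesis by blast
      qed
    qed
    moreover have "(\<Union>x\<in>I. T x) \<subseteq> ?P" by (auto simp: T_def)
    ultimately have "card ?P = card (\<Union>x\<in>I. T x)" by (metis subset_antisym)
    also have "\<dots> \<le> (\<Sum>x\<in>I. card (T x))" by (rule card_UN_le[OF finI])
    also have "\<dots> \<le> (\<Sum>x\<in>I. ?M)"
    proof (rule sum_mono)
      fix x assume "x \<in> I"
      moreover obtain i r q where "x = (i, r, q)" by (rule prod_cases3)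
      ultimately show "card (T x) \<le> ?M"
        unfolding T_def I_def
        by (simp only: prod.case mem_Collect_eq) (rule card_paths_repeated_color_le[OF G False]; simp)
    qed
    also have "\<dots> \<le> k ^ 3 * ?M" using \<open>card I \<le> k ^ 3\<close> by simp
    finally show ?thesis .
  qed
  moreover have "card (copies (path_graph k) G) \<le> card ?P"
    unfolding copies_path_graph[OF G(1)] by (rule card_image_le[OF finP])
  ultimately show ?thesis by linarith
qed

lemma rainbow_ex_path_le:
  assumes "k \<ge> 2"
  shows "rainbow_ex n (path_graph k) (path_graph k) \<le> k ^ 3 * (4 * k * n) ^ (k div 2)"
proof -
  \<comment> \<open>The path has an edge, so the set under \<open>Max\<close> is nonempty and the
    maximum is attained by some host graph.\<close>
  have "edges (path_graph k) \<noteq> {}" using assms by (auto simp: path_graph_def intro!: exI[of _ 0])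
  hence "rainbow_ex n (path_graph k) (path_graph k) \<in> rainbow_ex_counts n (path_graph k) (path_graph k)"
    unfolding rainbow_ex_def by (intro Max_in finite_rainbow_ex_counts rainbow_ex_counts_nonempty)
  then obtain G :: "nat graph" and c :: "nat set \<Rightarrow> nat" where
    eq: "rainbow_ex n (path_graph k) (path_graph k) = card (copies (path_graph k) G)"
    and G: "simple_graph G" "card (verts G) = n" "proper_coloring G c"
      "\<not> (\<exists>S\<in>copies (path_graph k) G. rainbow c S)"
    unfolding rainbow_ex_counts_def by blast
  have free: "\<not> (\<exists>f. is_path G k f \<and> rainbow_path c k f)"
    using G(4) rainbow_copy_iff[OF G(1)] by blast
  have "card (edges G) \<le> 2 * k * n"
    using rainbow_path_free_sparse[OF G(1,3) _ free] G(2) assms by simp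
  hence "(2 * card (edges G)) ^ (k div 2) \<le> (4 * k * n) ^ (k div 2)"
    by (intro power_mono) auto
  hence "k ^ 3 * (2 * card (edges G)) ^ (k div 2) \<le> k ^ 3 * (4 * k * n) ^ (k div 2)" by simp
  thus ?thesis using card_path_copies_le[OF G(1,3) free] eq by linarith
qed

section \<open>The hub graph and its proper colouring\<close>

definition hub :: "nat \<Rightarrow> bool" where
  "hub l \<longleftrightarrow> l = 1 \<or> (even l \<and> 4 \<le> l)"

text \<open>The vertex \<open>v\<close> has level \<open>v mod k\<close> and index \<open>v div k\<close> within its level; on a hub level only the
  vertex of index 0 is used, the others are isolated.\<close>

definition hub_arc :: "nat \<Rightarrow> nat \<Rightarrow> nat \<Rightarrow> bool" where
  "hub_arc k u v \<longleftrightarrow> v mod k = Suc (u mod k) \<and> (hub (u mod k) \<longrightarrow> u < k) \<and>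
     (hub (v mod k) \<longrightarrow> v < k) \<and> (u mod k = 2 \<longrightarrow> v = Suc u)"

definition hub_graph :: "nat \<Rightarrow> nat \<Rightarrow> nat graph" where
  "hub_graph k n = \<lparr>verts = {..<n}, edges = {{u, v} |u v. u < n \<and> v < n \<and> hub_arc k u v}\<rparr>"

text \<open>Two distinct edges sharing a vertex have different vertex sums, so sums are proper colours. The
  shift by 4 identifies the colours of \<open>{1, u}\<close> and \<open>{Suc u, 4}\<close>; the shift by \<open>2 * n + 5\<close> keeps the
  edges between levels 0 and 1 out of the way.\<close>

definition hub_color :: "nat \<Rightarrow> nat \<Rightarrow> nat set \<Rightarrow> nat" where
  "hub_color k n e = (let L = (\<lambda>x. x mod k) ` e in
     if 2 \<in> L \<and> 3 \<in> L then 0 else if 0 \<in> L then \<Sum>e + 2 * n + 5 else if 1 \<in> L then \<Sum>e + 4 else \<Sum>e)"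

text \<open>Levels along an arc are consecutive, so the level of the tail \<open>u\<close> alone
  selects the branch of the colour.\<close>

lemma hub_color_arc:
  assumes "hub_arc k u v"
  shows "hub_color k n {u, v} =
    (if u mod k = 2 then 0 else if u mod k = 0 then u + v + 2 * n + 5
     else if u mod k = 1 then u + v + 4 else u + v)"
proof -
  have "u \<noteq> v" using assms by (auto simp: hub_arc_def)
  thus ?thesis using assms by (auto simp: hub_color_def hub_arc_def Let_def)
qed

lemma simple_hub_graph: "simple_graph (hub_graph k n)"
  by (auto simp: simple_graph_def hub_graph_def hub_arc_def card_insert_if)

lemma hub_graph_edge_iff:
  "{u, v} \<in> edges (hub_graph k n) \<longleftrightarrow> u < n \<and> v < n \<and> (hub_arc k u v \<or> hub_arc k v u)"
  by (auto simp: hub_graph_def doubleton_eq_iff)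

text \<open>If both arcs leave \<open>x\<close> or both enter it, they have the same shift or the
  matching decides. Otherwise their tail levels are consecutive: 0 and 1 are told apart by the large
  shift since \<open>y\<close> and \<open>z\<close> are below \<open>n\<close>, level 2 is told
  apart from its neighbours because their colours are positive, and from level 3 on the colours are
  plain sums.\<close>

lemma hub_color_inj:
  assumes "{x, y} \<in> edges (hub_graph k n)" "{x, z} \<in> edges (hub_graph k n)"
    and eq: "hub_color k n {x, y} = hub_color k n {x, z}"
  shows "y = z"
proof -
  have lt: "x < n" "y < n" "z < n" and xy: "hub_arc k x y \<or> hub_arc k y x" 
    and xz: "hub_arc k x z \<or> hub_arc k z x"
    using assms by (auto simp: hub_graph_edge_iff)
  have c: "hub_color k n {x, w} = hub_color k n {w, x}" for w by (simp add: insert_commute)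
  obtain lx ly lz where l: "x mod k = lx" "y mod k = ly" "z mod k = lz" by blast
  have pos: "x > 0" if "lx > 0" using that l(1) by (cases x) auto
  consider "hub_arc k x y" "hub_arc k x z" | "hub_arc k x y" "hub_arc k z x"
    | "hub_arc k y x" "hub_arc k x z" | "hub_arc k y x" "hub_arc k z x" using xy xz by blast
  thus ?thesis
  proof cases
    case 1
    have "lx = 2 \<longrightarrow> y = Suc x \<and> z = Suc x" using 1 by (simp add: hub_arc_def l)
    thus ?thesis using eq unfolding hub_color_arc[OF 1(1)] hub_color_arc[OF 1(2)] l
      by (simp split: if_splits)
  next
    case 2
    have "lx = Suc lz" using 2 by (simp add: hub_arc_def l)
    thus ?thesis using eq lt pos unfolding c[of z] hub_color_arc[OF 2(1)] hub_color_arc[OF 2(2)] l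
      by (simp split: if_splits)
  next
    case 3
    have "lx = Suc ly" using 3 by (simp add: hub_arc_def l)
    thus ?thesis using eq lt pos unfolding c[of y] hub_color_arc[OF 3(1)] hub_color_arc[OF 3(2)] l
      by (simp split: if_splits)
  next
    case 4
    have "ly = lz" "lx = Suc ly" "ly = 2 \<longrightarrow> x = Suc y" "lz = 2 \<longrightarrow> x = Suc z"
      using 4 by (simp_all add: hub_arc_def l)
    thus ?thesis using eq unfolding c[of y] c[of z] hub_color_arc[OF 4(1)] hub_color_arc[OF 4(2)] l
      by (simp split: if_splits)
  qed
qed

lemma proper_hub_color: "proper_coloring (hub_graph k n) (hub_color k n)"
  unfolding proper_coloring_def
proof (intro ballI impI notI)
  fix e f assume e: "e \<in> edges (hub_graph k n)" and f: "f \<in> edges (hub_graph k n)"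
    and ef: "e \<noteq> f \<and> e \<inter> f \<noteq> {}" and eq: "hub_color k n e = hub_color k n f"
  then obtain x where x: "x \<in> e" "x \<in> f" by blast
  obtain y where "e = {x, y}" using simple_graph_edgeE[OF simple_hub_graph e x(1)] by metis
  moreover obtain z where "f = {x, z}" using simple_graph_edgeE[OF simple_hub_graph f x(2)] by metis
  ultimately show False using hub_color_inj[of x y k n z] e f ef eq by auto
qed

section \<open>Absence of rainbow paths in the hub graph\<close>

text \<open>Levels change by one along an edge, so after its last vertex before \<open>t\<close> of
  level at most 1 the path has to run through levels 1, 2, 3, 4. It starts this run at hub 1 and
  ends it at hub 4, and the first and third edges of the run share a colour.\<close>

lemma rainbow_hub_path_no_crossing:
  assumes k: "k \<ge> 5" and p: "is_path (hub_graph k n) k f"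
    and rb: "rainbow_path (hub_color k n) k f"
    and st: "s < t" "t < k" and l: "f s mod k \<le> 1" "f t mod k \<ge> 4"
  shows False
proof -
  define S where "S = {i. i < t \<and> f i mod k \<le> 1}"
  have "finite S" "S \<noteq> {}" using st l by (auto simp: S_def)
  define u where "u = Max S"
  have "u \<in> S" using \<open>finite S\<close> \<open>S \<noteq> {}\<close> Max_in u_def by blast
  hence u: "u < t" "f u mod k \<le> 1" by (auto simp: S_def)
  have gt: "f i mod k \<ge> 2" if "u < i" "i \<le> t" for i
  proof (rule ccontr)
    assume "\<not> f i mod k \<ge> 2"
    hence "i \<in> S" using that l(2) by (cases "i = t") (auto simp: S_def)
    hence "i \<le> u" using \<open>finite S\<close> by (simp add: u_def)
    thus False using that by simp
  qed
  have step: "hub_arc k (f i) (f (Suc i)) \<or> hub_arc k (f (Suc i)) (f i)" if "Suc i < k" for i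
    using is_path_edge[OF p that] by (simp add: hub_graph_edge_iff)
  have a1: "hub_arc k (f u) (f (Suc u))"
    using step[of u] u st gt[of "Suc u"] by (auto simp: hub_arc_def)
  have l1: "f u mod k = 1" "f (Suc u) mod k = 2"
    using a1 u st gt[of "Suc u"] by (auto simp: hub_arc_def)
  have "Suc u \<noteq> t" using l1 l(2) by auto
  hence u1: "Suc u < t" using u by simp
  have a2: "hub_arc k (f (Suc u)) (f (Suc (Suc u)))"
    using step[of "Suc u"] u1 st gt[of "Suc (Suc u)"] l1 by (auto simp: hub_arc_def)
  have l2: "f (Suc (Suc u)) = Suc (f (Suc u))" "f (Suc (Suc u)) mod k = 3"
    using a2 l1 by (auto simp: hub_arc_def)
  have "Suc (Suc u) \<noteq> t" using l2 l(2) by auto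
  hence u2: "Suc (Suc u) < t" using u1 by simp
  \<comment> \<open>Falling back from level 3 to level 2 would mean returning to the matching
    partner just left.\<close>
  have a3: "hub_arc k (f (Suc (Suc u))) (f (Suc (Suc (Suc u))))"
  proof (rule ccontr)
    assume "\<not> ?thesis"
    hence "hub_arc k (f (Suc (Suc (Suc u)))) (f (Suc (Suc u)))" using step[of "Suc (Suc u)"] u2 st by auto
    hence "f (Suc (Suc (Suc u))) = f (Suc u)" using l2 by (auto simp: hub_arc_def)
    thus False using is_path_eq_iff[OF p, of "Suc (Suc (Suc u))" "Suc u"] u2 st by simp
  qed
  have "f u = 1" using a1 l1 by (auto simp: hub_arc_def hub_def)
  moreover have "f (Suc (Suc (Suc u))) = 4"
  proof -
    have l4: "f (Suc (Suc (Suc u))) mod k = 4" using a3 l2(2) by (simp only: hub_arc_def)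
    moreover have "hub 4" by (simp add: hub_def)
    ultimately have "f (Suc (Suc (Suc u))) < k" using a3 by (simp only: hub_arc_def)
    thus ?thesis using l4 by simp
  qed
  \<comment> \<open>With \<open>w = f (Suc u)\<close> the colours are \<open>1 + w + 4\<close> and
    \<open>Suc w + 4\<close>.\<close>
  ultimately have "hub_color k n {f u, f (Suc u)} = hub_color k n {f (Suc (Suc u)), f (Suc (Suc (Suc u)))}"
    using hub_color_arc[OF a1, of n] hub_color_arc[OF a3, of n] l1 l2 by simp
  hence "u = Suc (Suc u)"
    using rb u2 st unfolding rainbow_path_def by (elim inj_onD) auto
  thus False by simp
qed

text \<open>Reversal handles the case in which hub 1 comes after the other hub on the path.\<close>

lemma is_path_rev:
  assumes "is_path G k f"
  shows "is_path G k (\<lambda>i. f (k - 1 - i))"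
  unfolding is_path_def
proof (intro conjI allI impI)
  show "(\<lambda>i. f (k - 1 - i)) ` {..<k} \<subseteq> verts G" using assms by (auto simp: is_path_def)
  show "inj_on (\<lambda>i. f (k - 1 - i)) {..<k}"
    using is_path_eq_iff[OF assms] by (intro inj_onI) auto
  fix i assume i: "Suc i < k"
  have "Suc (k - 1 - Suc i) = k - 1 - i" using i by auto
  thus "{f (k - 1 - i), f (k - 1 - Suc i)} \<in> edges G"
    using is_path_edge[OF assms, of "k - 1 - Suc i"] i by (simp add: insert_commute)
qed

lemma rainbow_path_rev:
  assumes "rainbow_path c k f"
  shows "rainbow_path c k (\<lambda>i. f (k - 1 - i))"
  unfolding rainbow_path_def
proof (rule inj_onI)
  fix i j assume "i \<in> {i. Suc i < k}" "j \<in> {i. Suc i < k}"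
    and eq: "c {f (k - 1 - i), f (k - 1 - Suc i)} = c {f (k - 1 - j), f (k - 1 - Suc j)}"
  hence ij: "Suc i < k" "Suc j < k" by auto
  have "Suc (k - 1 - Suc i) = k - 1 - i" "Suc (k - 1 - Suc j) = k - 1 - j" using ij by auto
  hence "c {f (k - 1 - Suc i), f (Suc (k - 1 - Suc i))} = c {f (k - 1 - Suc j), f (Suc (k - 1 - Suc j))}"
    using eq by (simp add: insert_commute)
  hence "k - 1 - Suc i = k - 1 - Suc j"
    using assms ij unfolding rainbow_path_def by (elim inj_onD) auto
  thus "i = j" using ij by auto
qed

lemma hub_graph_no_rainbow_path:
  assumes k: "k \<ge> 5"
  shows "\<not> (\<exists>f. is_path (hub_graph k n) k f \<and> rainbow_path (hub_color k n) k f)"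
proof
  assume "\<exists>f. is_path (hub_graph k n) k f \<and> rainbow_path (hub_color k n) k f"
  then obtain f where p: "is_path (hub_graph k n) k f" and rb: "rainbow_path (hub_color k n) k f"
    by blast
  define I where "I = {i. Suc i < k}"
  define Z where "Z = {i \<in> I. hub_color k n {f i, f (Suc i)} = 0}"
  define R where "R = {j. j < k \<and> hub (f j mod k) \<and> f j < k}"
  have card_I: "card I = k - 1" "finite I"
  proof -
    have "I = {..<k - 1}" by (auto simp: I_def)
    thus "card I = k - 1" "finite I" by auto
  qed
  have step: "hub_arc k (f i) (f (Suc i)) \<or> hub_arc k (f (Suc i)) (f i)" if "Suc i < k" for i
    using is_path_edge[OF p that] by (simp add: hub_graph_edge_iff)
  have finZ: "finite Z" using card_I(2) by (simp add: Z_def)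
  have "i = j" if "i \<in> Z" "j \<in> Z" for i j
    using that rb unfolding rainbow_path_def by (elim inj_onD) (simp_all add: Z_def I_def)
  hence "card Z \<le> 1" using card_le_Suc0_iff_eq[OF finZ] by auto
  have finR: "finite R" by (simp add: R_def)
  \<comment> \<open>An edge of nonzero colour is charged to a hub at position \<open>i\<close> or
    \<open>Suc i\<close>; the map to \<open>j - 1\<close> collects the second kind. Hence each hub
    is charged at most twice.\<close>
  have "I - Z \<subseteq> R \<union> (\<lambda>j. j - 1) ` R"
  proof
    fix i assume i: "i \<in> I - Z"
    hence ik: "Suc i < k" by (simp add: I_def)
    have c: "hub_color k n {f i, f (Suc i)} \<noteq> 0" using i by (simp add: Z_def)
    have key: "hub (u mod k) \<and> u < k \<or> hub (v mod k) \<and> v < k"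
      if a: "hub_arc k u v" "hub_color k n {u, v} \<noteq> 0" for u v
    proof -
      have "u mod k \<noteq> 2" using a hub_color_arc[OF a(1), of n] by auto
      moreover have "hub l \<or> hub (Suc l)" if "l \<noteq> 2" for l
        using that unfolding hub_def by presburger
      ultimately have "hub (u mod k) \<or> hub (Suc (u mod k))" by blast
      thus ?thesis using a(1) unfolding hub_arc_def by metis
    qed
    have "i \<in> R \<or> Suc i \<in> R"
      using step[OF ik] key[of "f i" "f (Suc i)"] key[of "f (Suc i)" "f i"] c ik
      by (auto simp: R_def insert_commute)
    thus "i \<in> R \<union> (\<lambda>j. j - 1) ` R" by force
  qed
  hence "card (I - Z) \<le> card (R \<union> (\<lambda>j. j - 1) ` R)" using finR by (intro card_mono) auto
  also have "\<dots> \<le> card R + card ((\<lambda>j. j - 1) ` R)" by (rule card_Un_le)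
  also have "\<dots> \<le> 2 * card R" using card_image_le[OF finR, of "\<lambda>j. j - 1"] by simp
  finally have "card (I - Z) \<le> 2 * card R" .
  moreover have "card (I - Z) \<ge> card I - card Z"
    by (rule diff_card_le_card_Diff[OF finZ])
  ultimately have kR: "k - 2 \<le> 2 * card R" using \<open>card Z \<le> 1\<close> card_I(1) by simp
  have inj: "inj_on f R" using p by (auto simp: is_path_def R_def inj_on_def)
  have cR: "card R \<le> card A" if "f ` R \<subseteq> A" "finite A" for A
    using card_inj_on_le[OF inj that] .
  have "\<exists>s\<in>R. f s = 1"
  proof (rule ccontr)
    assume no: "\<not> (\<exists>s\<in>R. f s = 1)"
    \<comment> \<open>The hubs below \<open>k\<close> other than 1 are 4, 6, 8, ..., which makes
      \<open>(k - 3) div 2\<close> of them. They alone would give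
      \<open>k - 2 <= k - 3\<close>.\<close>
    have "f ` R \<subseteq> (\<lambda>j. 2 * j + 4) ` {..<(k - 3) div 2}"
    proof
      fix l assume "l \<in> f ` R"
      hence "even l" "4 \<le> l" "l < k" using no by (auto simp: R_def hub_def)
      hence "l = 2 * ((l - 4) div 2) + 4" "(l - 4) div 2 < (k - 3) div 2" by presburger+
      thus "l \<in> (\<lambda>j. 2 * j + 4) ` {..<(k - 3) div 2}" by blast
    qed
    from cR[OF this] have "card R \<le> card ((\<lambda>j. 2 * j + 4) ` {..<(k - 3) div 2})" by simp
    also have "\<dots> \<le> (k - 3) div 2" using card_image_le[of "{..<(k - 3) div 2}"] by simp
    finally show False using kR k by linarith
  qed
  then obtain s where s: "s < k" "f s = 1" by (auto simp: R_def)
  have "\<exists>t\<in>R. f t \<noteq> 1"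
  proof (rule ccontr)
    assume "\<not> (\<exists>t\<in>R. f t \<noteq> 1)"
    \<comment> \<open>Hub 1 alone would give \<open>k - 2 <= 2\<close>.\<close>
    hence "f ` R \<subseteq> {1}" by auto
    from cR[OF this] show False using kR k by simp
  qed
  then obtain t where t: "t < k" "f t mod k \<ge> 4" by (auto simp: R_def hub_def)
  have s1: "f s mod k \<le> 1" using s k by simp
  have "s \<noteq> t" using s1 t by auto
  then consider "s < t" | "t < s" by linarith
  thus False
  proof cases
    case 1
    thus False using rainbow_hub_path_no_crossing[OF k p rb _ t(1) s1 t(2)] by simp
  next
    case 2
    have "k - 1 - s < k - 1 - t" "k - 1 - t < k" "k - 1 - (k - 1 - s) = s" "k - 1 - (k - 1 - t) = t"
      using 2 s(1) t(1) by linarith+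
    thus False
      using rainbow_hub_path_no_crossing[OF k is_path_rev[OF p] rainbow_path_rev[OF rb],
          of "k - 1 - s" "k - 1 - t"] t(2) s1 by metis
  qed
qed

section \<open>Counting the paths through all levels\<close>

text \<open>The levels that are not hubs are 0, 2, 3, 5, 7, and so on. Hence \<open>l div 2\<close>
  makes levels 2 and 3 share a value of \<open>g\<close>, as the matching requires, while every
  other such level gets an argument of its own.\<close>

definition transversal :: "nat \<Rightarrow> (nat \<Rightarrow> nat) \<Rightarrow> nat \<Rightarrow> nat" where
  "transversal k g l = (if hub l then l else g (l div 2) * k + l)"

lemma transversal_mod: "l < k \<Longrightarrow> transversal k g l mod k = l"
  by (simp add: transversal_def)

lemma is_path_transversal:
  assumes k: "k \<ge> 5" and g: "\<And>j. j < k div 2 \<Longrightarrow> g j < n div k" and n: "n \<ge> k"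
  shows "is_path (hub_graph k n) k (transversal k g)"
  unfolding is_path_def
proof (intro conjI allI impI)
  have lt: "transversal k g l < n" if l: "l < k" for l
  proof (cases "hub l")
    case True
    thus ?thesis using l n by (simp add: transversal_def)
  next
    case False
    \<comment> \<open>For odd \<open>k\<close> the top level \<open>k - 1\<close> would need
      \<open>g (k div 2)\<close>, but it is a hub.\<close>
    have "l div 2 < k div 2"
    proof (rule ccontr)
      assume "\<not> ?thesis"
      hence "even l" "4 \<le> l" using l k by presburger+
      thus False using False by (simp add: hub_def)
    qed
    hence "Suc (g (l div 2)) \<le> n div k" using g by (simp add: Suc_leI)
    hence "Suc (g (l div 2)) * k \<le> n div k * k" by (rule mult_le_mono1)
    also have "\<dots> \<le> n" by simp
    finally show ?thesis using l False by (simp add: transversal_def)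
  qed
  thus "transversal k g ` {..<k} \<subseteq> verts (hub_graph k n)" by (auto simp: hub_graph_def)
  show "inj_on (transversal k g) {..<k}"
    by (rule inj_on_inverseI[of _ "\<lambda>x. x mod k"]) (simp add: transversal_mod)
  fix i assume i: "Suc i < k"
  have "hub_arc k (transversal k g i) (transversal k g (Suc i))"
    using i transversal_mod[of i k g] transversal_mod[of "Suc i" k g]
    by (auto simp: hub_arc_def transversal_def hub_def)
  thus "{transversal k g i, transversal k g (Suc i)} \<in> edges (hub_graph k n)"
    using lt[of i] lt[of "Suc i"] i by (simp add: hub_graph_edge_iff)
qed

text \<open>A transversal path has one vertex on each level, so its vertex set alone determines the
  sequence and thereby \<open>g\<close>. No copy is counted twice, although copies forget the
  direction.\<close>

lemma card_hub_graph_copies: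
  assumes k: "k \<ge> 5" and n: "n \<ge> k"
  shows "(n div k) ^ (k div 2) \<le> card (copies (path_graph k) (hub_graph k n))"
proof -
  let ?A = "{..<k div 2} \<rightarrow>\<^sub>E {..<n div k}"
  let ?h = "\<lambda>g. path_image k (restrict (transversal k g) {..<k})"
  let ?P = "{f \<in> extensional {..<k}. is_path (hub_graph k n) k f}"
  have "?P \<subseteq> {..<k} \<rightarrow>\<^sub>E {..<n}"
    by (auto simp: is_path_def hub_graph_def PiE_def)
  hence fin: "finite (copies (path_graph k) (hub_graph k n))"
    unfolding copies_path_graph[OF simple_hub_graph]
    by (intro finite_imageI) (erule finite_subset, simp add: finite_PiE)
  have "?h ` ?A \<subseteq> copies (path_graph k) (hub_graph k n)"
  proof
    fix S assume "S \<in> ?h ` ?A"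
    then obtain g where g: "g \<in> ?A" "S = ?h g" by auto
    have "is_path (hub_graph k n) k (transversal k g)"
      by (rule is_path_transversal[OF k _ n]) (use g(1) in auto)
    hence "is_path (hub_graph k n) k (restrict (transversal k g) {..<k})"
      by (auto simp: is_path_def inj_on_def)
    thus "S \<in> copies (path_graph k) (hub_graph k n)"
      using g(2) by (auto simp: copies_path_graph[OF simple_hub_graph])
  qed
  moreover have "inj_on ?h ?A"
  proof (rule inj_onI)
    fix g g' assume g: "g \<in> ?A" "g' \<in> ?A" and eq: "?h g = ?h g'"
    have img: "transversal k g ` {..<k} = transversal k g' ` {..<k}"
      using arg_cong[OF eq, of verts] by (simp add: path_image_def)
    have tr: "transversal k g l = transversal k g' l" if l: "l < k" for l
    proof -
      from l img obtain l' where l': "l' < k" "transversal k g l = transversal k g' l'" by blast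
      hence "l = l'" using transversal_mod[OF l, of g] transversal_mod[OF l'(1), of g'] by simp
      thus ?thesis using l' by simp
    qed
    have "g j = g' j" if j: "j < k div 2" for j
    proof -
      \<comment> \<open>A level without a hub that uses \<open>g j\<close>: in general
        \<open>2 * j + 1\<close>, but level 1 is a hub, so level 0 serves for
        \<open>j = 0\<close>.\<close>
      define l where "l = (if j = 0 then 0 else 2 * j + 1)"
      have "l < k" "\<not> hub l" "l div 2 = j" using j by (auto simp: l_def hub_def)
      thus ?thesis using tr[of l] k by (simp add: transversal_def)
    qed
    thus "g = g'" using g by (intro PiE_ext) auto
  qed
  ultimately have "card ?A \<le> card (copies (path_graph k) (hub_graph k n))"
    using fin by (intro card_inj_on_le)
  thus ?thesis by (simp add: card_PiE)
qed

lemma rainbow_ex_path_ge: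
  assumes "k \<ge> 5" "n \<ge> k"
  shows "(n div k) ^ (k div 2) \<le> rainbow_ex n (path_graph k) (path_graph k)"
proof -
  have "card (copies (path_graph k) (hub_graph k n)) \<in> rainbow_ex_counts n (path_graph k) (path_graph k)"
    unfolding rainbow_ex_counts_def
    using hub_graph_no_rainbow_path[OF assms(1), of n] rainbow_copy_iff[OF simple_hub_graph, of k k n]
      simple_hub_graph[of k n] proper_hub_color[of k n]
    by (intro CollectI exI[of _ "hub_graph k n"] exI[of _ "hub_color k n"])
      (auto simp: hub_graph_def)
  hence "card (copies (path_graph k) (hub_graph k n)) \<le> rainbow_ex n (path_graph k) (path_graph k)"
    unfolding rainbow_ex_def by (intro Max_ge finite_rainbow_ex_counts)
  thus ?thesis using card_hub_graph_copies[OF assms] by linarith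
qed

section \<open>From the explicit bounds to the order of growth\<close>

theorem theorem1p1:
  fixes k :: nat
  assumes "k \<ge> 5"
  shows "(\<lambda>n. real (rainbow_ex n (path_graph k) (path_graph k)))
           \<in> \<Theta>(\<lambda>n. real n ^ (k div 2))"
proof (rule bigthetaI)
  show "(\<lambda>n. real (rainbow_ex n (path_graph k) (path_graph k))) \<in> O(\<lambda>n. real n ^ (k div 2))"
  proof (rule bigoI, rule always_eventually, rule allI)
    fix n
    have "real (rainbow_ex n (path_graph k) (path_graph k)) \<le> real (k ^ 3 * (4 * k * n) ^ (k div 2))"
      using rainbow_ex_path_le[of k n] assms by (subst of_nat_le_iff) simp
    thus "norm (real (rainbow_ex n (path_graph k) (path_graph k)))
        \<le> real (k ^ 3 * (4 * k) ^ (k div 2)) * norm (real n ^ (k div 2))"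
      by (simp add: power_mult_distrib mult.assoc)
  qed
  show "(\<lambda>n. real (rainbow_ex n (path_graph k) (path_graph k))) \<in> \<Omega>(\<lambda>n. real n ^ (k div 2))"
  proof (rule landau_omega.bigI)
    \<comment> \<open>For \<open>n >= k\<close> the remainder of \<open>n\<close> is less than
      \<open>k\<close>, hence less than \<open>n div k * k\<close>, so \<open>n div k\<close> is at
      least \<open>n / (2 * k)\<close>.\<close>
    show "(1 / real (2 * k)) ^ (k div 2) > 0" using assms by simp
    show "eventually (\<lambda>n. norm (real (rainbow_ex n (path_graph k) (path_graph k)))
        \<ge> (1 / real (2 * k)) ^ (k div 2) * norm (real n ^ (k div 2))) at_top"
      using eventually_ge_at_top[of k]
    proof eventually_elim
      case (elim n)
      have "n = n div k * k + n mod k" "n mod k < k" "n div k \<ge> 1"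
        using elim assms by (auto simp: div_greater_zero_iff Suc_le_eq)
      moreover from this(3) have "k \<le> n div k * k" by simp
      ultimately have "n \<le> 2 * (n div k * k)" by linarith
      hence "real n \<le> real (2 * (n div k * k))" by (rule of_nat_mono)
      hence "real n / real (2 * k) \<le> real (n div k)"
        using assms by (simp add: field_simps)
      hence "(real n / real (2 * k)) ^ (k div 2) \<le> real (n div k) ^ (k div 2)"
        by (intro power_mono) auto
      also have "\<dots> \<le> real (rainbow_ex n (path_graph k) (path_graph k))"
        using rainbow_ex_path_ge[OF assms elim] by (metis of_nat_le_iff of_nat_power)
      finally show ?case by (simp add: power_divide)
    qed
  qed
qed

end
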